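(* Let $\beta \in [1/2, \log_2(3/2)]$ and let $C_\beta = 2\sqrt{2^{\beta+1}-2}$. For every integer $n \ge 1$ and every $A \subset \{0,1\}^n$, $$\mathbb{E}\, h_A^{\beta} \;\ge\; C_\beta\, \mu(A)\,(1-\mu(A)).$$
   Context: The hypercube $\{0,1\}^n$ is regarded as a graph in which two vertices are adjacent iff they differ in exactly one coordinate. $\mu$ is the uniform probability measure on $\{0,1\}^n$ and $\mathbb{E}$ is expectation with respect to $\mu$. For $A \subset \{0,1\}^n$, $h_A:\{0,1\}^n \to \mathbb{R}$ is defined by $h_A(x)=0$ if $x \notin A$, and, if $x \in A$, $h_A(x)$ is the number of neighbours of $x$ lying in $A^c = \{0,1\}^n\setminus A$. *)

theory Defs
  imports "HOL-Probability.Probability"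
begin

(* The coordinates of a point of {0,1}^n are indexed by {0,...,n-1}; outside this range a point
   takes the value "undefined", so that distinct functions are distinct points. *)
definition hypercube :: "nat \<Rightarrow> (nat \<Rightarrow> nat) set" where
  "hypercube n = {..<n} \<rightarrow>\<^sub>E {0, 1}"

definition hypercube_adj :: "nat \<Rightarrow> (nat \<Rightarrow> nat) \<Rightarrow> (nat \<Rightarrow> nat) \<Rightarrow> bool" where
  "hypercube_adj n x y \<longleftrightarrow> x \<in> hypercube n \<and> y \<in> hypercube n \<and> card {i. i < n \<and> x i \<noteq> y i} = 1"

definition hypercube_unif :: "nat \<Rightarrow> (nat \<Rightarrow> nat) pmf" where
  "hypercube_unif n = pmf_of_set (hypercube n)"

definition hypercube_h :: "nat \<Rightarrow> (nat \<Rightarrow> nat) set \<Rightarrow> (nat \<Rightarrow> nat) \<Rightarrow> real" where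
  "hypercube_h n A x =
     (if x \<in> A then real (card {y \<in> hypercube n - A. hypercube_adj n x y}) else 0)"

definition C_const :: "real \<Rightarrow> real" where
  "C_const \<beta> = 2 * sqrt (2 powr (\<beta> + 1) - 2)"

(* pmf_of_set is meaningful only for finite nonempty sets. *)
lemma finite_hypercube: "finite (hypercube n)"
  by (simp add: hypercube_def finite_PiE)

lemma hypercube_nonempty: "hypercube n \<noteq> {}"
  by (simp add: hypercube_def PiE_eq_empty_iff)

end

theory Submission
  imports Defs
begin

text \<open>
  Induction on \<open>n\<close>: cut \<open>A\<close> along the last coordinate into slices of measures \<open>x \<ge> y\<close>, and let \<open>S\<close> be the
  set of points of the larger slice missing from the smaller one, so \<open>\<mu>(S) \<ge> d = x - y\<close>. On \<open>S\<close> the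
  value of \<open>h\<close> goes up by one. Writing \<open>B(x) = C x (1 - x)\<close>, the larger slice has to gain
  \<open>2 B((x + y) / 2) - B(x) - B(y) = C d\<^sup>2 / 2\<close>. A pointwise bound
  \<open>(h + 1) powr \<beta> \<ge> a + (1 - q) * h powr \<beta>\<close>, valid for all integers \<open>h \<ge> 0\<close>, gives a gain of at least
  \<open>a d - q B(x)\<close> relative to \<open>B(x)\<close>. With \<open>c = 2 powr \<beta> - 1 \<le> 1/2\<close>, one takes \<open>(a, q) = (1, 1 - c)\<close> if
  \<open>B(x) \<le> d\<close>, and \<open>(a, q) = (2 c / t, c / t\<^sup>2)\<close> with \<open>t = B(x) / d\<close> otherwise. The second case needs
  \<open>C\<^sup>2 x (1 - x) \<le> 2 c\<close>, which at \<open>x = 1/2\<close> is an equality for \<open>C\<^sup>2 = 8 c\<close>.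
\<close>

section \<open>Growth of \<open>h powr \<beta>\<close> when \<open>h\<close> increases by
  one\<close>

text \<open>By concavity the power function lies above its chord over \<open>{1..2}\<close>.\<close>

lemma one_plus_powr_ge:
  fixes \<beta> s :: real
  assumes "0 \<le> \<beta>" "\<beta> \<le> 1" "0 \<le> s" "s \<le> 1"
  shows "1 + (2 powr \<beta> - 1) * s \<le> (1 + s) powr \<beta>"
proof -
  have "concave_on {1..2} (\<lambda>x. x powr \<beta>)"
  proof (rule f''_le0_imp_concave)
    show "((\<lambda>x. x powr \<beta>) has_real_derivative \<beta> * x powr (\<beta> - 1)) (at x)"
      if "x \<in> {1..2}" for x
      using that by (auto intro!: derivative_eq_intros)
    show "((\<lambda>x. \<beta> * x powr (\<beta> - 1)) has_real_derivative \<beta> * (\<beta> - 1) * x powr (\<beta> - 2)) (at x)"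
      if "x \<in> {1..2}" for x
      using that by (auto intro!: derivative_eq_intros)
    show "\<beta> * (\<beta> - 1) * x powr (\<beta> - 2) \<le> 0" for x
      using assms by (simp add: mult_nonneg_nonpos mult_nonpos_nonneg)
  qed simp
  from concave_onD_Icc'[OF this, of "1 + s"] show ?thesis
    using assms by simp
qed

text \<open>After \<open>h powr \<beta>\<close> is factored out, the chord bound applies with
  \<open>s = 1 / h\<close>; \<beta> \<ge> 1/2 turns its term \<open>h powr (\<beta> - 1)\<close>
  into the smaller \<open>h powr - \<beta>\<close>.\<close>

lemma Suc_powr_ge:
  fixes \<beta> :: real and h :: nat
  assumes "1 / 2 \<le> \<beta>" "\<beta> \<le> 1" "1 \<le> h"
  shows "h powr \<beta> + (2 powr \<beta> - 1) / h powr \<beta> \<le> (real h + 1) powr \<beta>"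
proof -
  have c: "2 powr \<beta> - 1 \<ge> 0"
    using assms ge_one_powr_ge_zero[of 2 \<beta>] by simp
  have "real h powr - \<beta> \<le> real h powr (\<beta> - 1)"
    using assms by (intro powr_mono) auto
  also have "\<dots> = h powr \<beta> * (1 / h)"
    using assms by (simp add: powr_diff)
  finally have le: "real h powr - \<beta> \<le> h powr \<beta> * (1 / h)" .
  have "h powr \<beta> + (2 powr \<beta> - 1) * real h powr - \<beta>
      \<le> h powr \<beta> + (2 powr \<beta> - 1) * (h powr \<beta> * (1 / h))"
    by (rule add_left_mono[OF mult_left_mono[OF le c]])
  also have "\<dots> = h powr \<beta> * (1 + (2 powr \<beta> - 1) * (1 / h))"
    by (simp only: distrib_left mult_1_right mult.left_commute)
  also have "\<dots> \<le> h powr \<beta> * (1 + 1 / h) powr \<beta>"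
    using assms by (intro mult_left_mono one_plus_powr_ge) auto
  also have "\<dots> = (h * (1 + 1 / h)) powr \<beta>"
    by (simp add: powr_mult)
  also have "h * (1 + 1 / h) = real h + 1"
    using assms by (simp add: field_simps)
  finally show ?thesis
    by (simp add: powr_minus divide_inverse add_ac)
qed

text \<open>The next two lemmas bound \<open>(h + 1) powr \<beta>\<close> from below by affine functions of \<open>h powr \<beta>\<close>: one is
  exact at \<open>h = 0\<close> and \<open>h = 1\<close>, the other comes from the tangent at \<open>t\<close> of the convex function
  \<open>u \<mapsto> c / u\<close>. Integrality of \<open>h\<close> is essential for the first one.\<close>

lemma Suc_powr_ge_chord:
  fixes \<beta> :: real and h :: nat
  assumes "1 / 2 \<le> \<beta>" "2 powr \<beta> \<le> 3 / 2"
  shows "1 + (2 powr \<beta> - 1) * h powr \<beta> \<le> (real h + 1) powr \<beta>"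
proof (cases "h = 0")
  case False
  have b1: "\<beta> \<le> 1"
    using assms powr_less_mono[of 1 \<beta> 2] by (cases "\<beta> \<le> 1") auto
  define c f where "c = 2 powr \<beta> - 1" and "f = real h powr \<beta>"
  have f: "f \<ge> 1"
    unfolding f_def using assms False by (intro ge_one_powr_ge_zero) auto
  have c: "0 \<le> c" "c \<le> 1 / 2"
    using assms ge_one_powr_ge_zero[of 2 \<beta>] by (auto simp: c_def)
  \<comment> \<open>Both factors are nonnegative: \<open>f \<ge> 1\<close> since
    \<open>h \<ge> 1\<close>, and \<open>f * (1 - c) \<ge> 1 / 2 \<ge> c\<close>.\<close>
  have "(f + c / f) - (1 + c * f) = (f - 1) * (f * (1 - c) - c) / f"
    using f by (simp add: field_simps)
  moreover have "1 * (1 / 2) \<le> f * (1 - c)"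
    using c f by (intro mult_mono) auto
  hence "0 \<le> (f - 1) * (f * (1 - c) - c) / f"
    using c f by (intro divide_nonneg_nonneg mult_nonneg_nonneg) auto
  moreover have "f + c / f \<le> (real h + 1) powr \<beta>"
    using Suc_powr_ge[of \<beta> h] assms b1 False by (simp add: c_def f_def)
  ultimately show ?thesis
    by (simp add: c_def f_def)
qed simp

lemma Suc_powr_ge_tangent:
  fixes \<beta> t :: real and h :: nat
  assumes "1 / 2 \<le> \<beta>" "2 powr \<beta> \<le> 3 / 2" "1 \<le> t"
  defines "c \<equiv> 2 powr \<beta> - 1"
  shows "2 * c / t + (1 - c / t\<^sup>2) * h powr \<beta> \<le> (real h + 1) powr \<beta>"
proof (cases "h = 0")
  case True
  \<comment> \<open>As \<open>0 powr \<beta> = 0\<close>, this is \<open>2 * c / t \<le> 1\<close>,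
    true by \<open>c \<le> 1 / 2\<close> and \<open>t \<ge> 1\<close>.\<close>
  then show ?thesis
    using assms by (simp add: field_simps)
next
  case False
  have b1: "\<beta> \<le> 1"
    using assms powr_less_mono[of 1 \<beta> 2] by (cases "\<beta> \<le> 1") auto
  define f where "f = real h powr \<beta>"
  have f: "f > 0"
    unfolding f_def using False by simp
  have "c \<ge> 0"
    using assms ge_one_powr_ge_zero[of 2 \<beta>] by (auto simp: c_def)
  \<comment> \<open>This square is exactly the distance from \<open>c / f\<close> down to the
    tangent at \<open>t\<close>.\<close>
  hence "0 \<le> c / f * (1 - f / t)\<^sup>2"
    using f by simp
  also have "\<dots> = (f + c / f) - (2 * c / t + (1 - c / t\<^sup>2) * f)"
    using f assms by (simp add: field_simps power2_eq_square)
  also have "f + c / f \<le> (real h + 1) powr \<beta>"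
    using Suc_powr_ge[of \<beta> h] assms b1 False by (simp add: c_def f_def)
  finally show ?thesis
    by (simp add: f_def)
qed

section \<open>The gain \<open>C * d\<^sup>2 / 2\<close> obtained from either pointwise
  bound\<close>

text \<open>The slack is concave in \<open>d\<close>, so only the extreme values
  \<open>C * (x * (1 - x))\<close> and \<open>x\<close> of \<open>d\<close> matter. The first rests
  on \<open>x * (1 - x) \<le> 1 / 4\<close>, the second on \<open>C \<le> 2 * c + 1\<close>.\<close>

lemma chord_bound_suffices:
  fixes C c x d :: real
  assumes C: "C\<^sup>2 = 8 * c" "0 < C" and c: "c \<le> 1 / 2"
    and x: "0 \<le> x" "x \<le> 1" and d: "C * (x * (1 - x)) \<le> d" "d \<le> x"
  shows "C * d\<^sup>2 / 2 \<le> d - (1 - c) * (C * (x * (1 - x)))"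
proof -
  define p where "p = C * (x * (1 - x))"
  have c0: "c > 0"
    using C by (metis zero_less_mult_pos zero_less_numeral zero_less_power)
  have C2: "C \<le> 2"
    by (rule power2_le_imp_le) (use C c in auto)
  have p0: "p \<ge> 0"
    using x C by (simp add: p_def)
  have u: "x * (1 - x) \<le> 1 / 4"
    using zero_le_square[of "x - 1 / 2"] by (simp add: algebra_simps)
  have at_p: "C * p / 2 \<le> c"
  proof -
    have "C * p / 2 = C\<^sup>2 * (x * (1 - x)) / 2"
      by (simp add: p_def power2_eq_square)
    also have "\<dots> = 4 * c * (x * (1 - x))"
      by (simp add: C)
    also have "\<dots> \<le> 4 * c * (1 / 4)"
      using c0 u by (intro mult_left_mono) auto
    finally show ?thesis by simp
  qed
  have at_x: "(1 - c) * p \<le> x * (1 - C * x / 2)"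
  proof (cases "x = 0")
    case False
    hence x0: "x > 0" using x by simp
    have "x * (C * (1 - x)) \<le> x * 1"
      using d by (simp add: algebra_simps)
    hence a: "C * (1 - x) \<le> 1"
      using x0 by simp
    have "(2 * c + 1)\<^sup>2 - C\<^sup>2 = (2 * c - 1)\<^sup>2"
      unfolding C by (simp add: power2_eq_square algebra_simps)
    hence "C\<^sup>2 \<le> (2 * c + 1)\<^sup>2"
      by (metis diff_ge_0_iff_ge zero_le_power2)
    hence "C \<le> 2 * c + 1"
      by (rule power2_le_imp_le) (use c0 in simp)
    \<comment> \<open>The parts \<open>1/2 - c\<close> and \<open>1/2\<close> of
      \<open>1 - c\<close> are treated separately, by \<open>C * (1 - x) \<le> 1\<close> and by
      \<open>C \<le> 2 * c + 1\<close>.\<close>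
    moreover have "(1/2 - c) * (C * (1 - x)) \<le> (1/2 - c) * 1"
      using c a by (intro mult_left_mono) auto
    moreover have "(1 - c) * (C * (1 - x)) = (1/2 - c) * (C * (1 - x)) + C / 2 - C * x / 2"
      by (simp add: field_simps)
    ultimately have "(1 - c) * (C * (1 - x)) \<le> 1 - C * x / 2"
      by argo
    hence "x * ((1 - c) * (C * (1 - x))) \<le> x * (1 - C * x / 2)"
      using x by (intro mult_left_mono) auto
    thus ?thesis by (simp add: p_def algebra_simps)
  qed (simp add: p_def)
  have px: "p \<le> d" using d by (simp add: p_def)
  show ?thesis
  proof (cases "p = x")
    case True
    hence "d = p" using d px by simp
    have "p * (C * p / 2) \<le> p * c" using at_p p0 by (intro mult_left_mono)
    thus ?thesis
      unfolding \<open>d = p\<close> p_def[symmetric] by (simp add: power2_eq_square algebra_simps)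
  next
    case False
    hence lt: "p < x" using px d by simp
    \<comment> \<open>\<open>g\<close> is concave, so it suffices that it is nonnegative at both ends of \<open>{p..x}\<close>.\<close>
    define g where "g = (\<lambda>z. z - (1 - c) * p - C * z\<^sup>2 / 2)"
    have gp: "g p \<ge> 0"
      using mult_left_mono[OF at_p p0] by (simp add: g_def power2_eq_square algebra_simps)
    have gx: "g x \<ge> 0"
      using at_x by (simp add: g_def power2_eq_square algebra_simps)
    have "(x - p) * g d = (x - d) * g p + (d - p) * g x + C / 2 * (x - d) * (d - p) * (x - p)"
      by (simp add: g_def power2_eq_square field_simps)
    also have "\<dots> \<ge> 0"
      using gp gx px d lt C by (intro add_nonneg_nonneg mult_nonneg_nonneg) auto
    finally have "g d \<ge> 0"
      using lt by (simp add: zero_le_mult_iff)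
    thus ?thesis by (simp add: g_def p_def)
  qed
qed

text \<open>Once \<open>t * d\<close> is substituted, the right-hand side collapses to
  \<open>c * d / t\<close>.\<close>

lemma tangent_bound_suffices:
  fixes C c x d t :: real
  assumes C: "C\<^sup>2 = 8 * c" "0 < C" and d: "0 < d" 
    and t: "0 < t" "C * (x * (1 - x)) = t * d"
  shows "C * d\<^sup>2 / 2 \<le> 2 * c / t * d - c / t\<^sup>2 * (C * (x * (1 - x)))"
proof -
  have c0: "c > 0"
    using C by (metis zero_less_mult_pos zero_less_numeral zero_less_power)
  have u: "x * (1 - x) \<le> 1 / 4"
    using zero_le_square[of "x - 1 / 2"] by (simp add: algebra_simps)
  have "C * (t * d) = 8 * c * (x * (1 - x))"
    using C t(2) by (metis power2_eq_square mult.assoc)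
  also have "\<dots> \<le> 8 * c * (1 / 4)"
    using u c0 by (intro mult_left_mono) auto
  finally have "C * d / 2 \<le> c / t"
    using t by (simp add: field_simps)
  hence "C * d / 2 * d \<le> c / t * d"
    using d by (intro mult_right_mono) auto
  thus ?thesis
    unfolding t(2) using t by (simp add: power2_eq_square field_simps)
qed

text \<open>Here \<open>x \<ge> y\<close> are the measures of the two slices of \<open>A\<close>, \<open>F0\<close> and \<open>F1\<close> their values of the functional,
  \<open>W\<close> is the measure of the larger slice minus the smaller one, and \<open>G\<close> is the contribution of the
  larger slice to the functional of \<open>A\<close>.\<close>

lemma two_point_step:
  fixes \<beta> C x y F0 F1 G W :: real
  assumes \<beta>: "1 / 2 \<le> \<beta>" "2 powr \<beta> \<le> 3 / 2"
    and C: "C\<^sup>2 = 8 * (2 powr \<beta> - 1)" "0 < C"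
    and xy: "0 \<le> y" "y \<le> x" "x \<le> 1"
    and F0: "C * (x * (1 - x)) \<le> F0" and F1: "C * (y * (1 - y)) \<le> F1"
    and W: "x - y \<le> W"
    and G: "\<And>a q. 0 \<le> a \<Longrightarrow> 0 \<le> q \<Longrightarrow>
      (\<And>h::nat. a + (1 - q) * h powr \<beta> \<le> (real h + 1) powr \<beta>) \<Longrightarrow> (1 - q) * F0 + a * W \<le> G"
  shows "2 * C * ((x + y) / 2 * (1 - (x + y) / 2)) \<le> G + F1"
proof -
  define c d B where "c = 2 powr \<beta> - 1" and "d = x - y" and "B = C * (x * (1 - x))"
  have c: "0 \<le> c" "c \<le> 1 / 2"
    using \<beta> ge_one_powr_ge_zero[of 2 \<beta>] by (auto simp: c_def)
  have B0: "B \<ge> 0"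
    using xy C by (simp add: B_def)
  have C': "C\<^sup>2 = 8 * c"
    using C by (simp add: c_def)
  \<comment> \<open>The assumption on \<open>G\<close> as a gain over \<open>B\<close>;
    \<open>q \<le> 1\<close> allows \<open>F0\<close> to be replaced by its lower bound
    \<open>B\<close>.\<close>
  have *: "B + (a * d - q * B) \<le> G" if "0 \<le> a" "0 \<le> q" "q \<le> 1"
    "\<And>h::nat. a + (1 - q) * h powr \<beta> \<le> (real h + 1) powr \<beta>" for a q
  proof -
    have "B + (a * d - q * B) = (1 - q) * B + a * d"
      by (simp add: algebra_simps)
    also have "\<dots> \<le> (1 - q) * F0 + a * W"
      using that F0 W by (intro add_mono mult_left_mono) (auto simp: B_def d_def)
    also have "\<dots> \<le> G"
      by (rule G) (use that in auto)
    finally show ?thesis .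
  qed
  have "B + C * d\<^sup>2 / 2 \<le> G"
  proof -
    consider "d = 0" | "B \<le> d" "d > 0" | "d < B" "d > 0"
      using xy by (fastforce simp: d_def)
    thus ?thesis
    proof cases
      case 1
      have "real h powr \<beta> \<le> (real h + 1) powr \<beta>" for h :: nat
        using \<beta> by (intro powr_mono2) auto
      thus ?thesis using *[of 0 0] 1 by (simp add: add.commute)
    next
      case 2
      have "B + (1 * d - (1 - c) * B) \<le> G"
        by (rule *) (use c Suc_powr_ge_chord[OF \<beta>] in \<open>auto simp: c_def add.commute\<close>)
      moreover have "C * d\<^sup>2 / 2 \<le> d - (1 - c) * B"
        unfolding B_def by (rule chord_bound_suffices) (use C' C c xy 2 in \<open>auto simp: B_def d_def\<close>)
      ultimately show ?thesis by simp
    next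
      case 3
      \<comment> \<open>This tangent point maximises the gain
        \<open>2 * c / t * d - c / t\<^sup>2 * B\<close> over \<open>t > 0\<close>.\<close>
      define t where "t = B / d"
      have t: "t > 1" "B = t * d"
        using 3 by (auto simp: t_def)
      have "1 \<le> t\<^sup>2"
        using t by simp
      hence "c / t\<^sup>2 \<le> 1"
        using c by (simp add: divide_le_eq)
      hence "B + (2 * c / t * d - c / t\<^sup>2 * B) \<le> G"
        by (intro *) (use c t Suc_powr_ge_tangent[OF \<beta>, of t, folded c_def] in auto)
      moreover have "C * d\<^sup>2 / 2 \<le> 2 * c / t * d - c / t\<^sup>2 * B"
        unfolding B_def by (rule tangent_bound_suffices) (use C' C c xy 3 t in \<open>auto simp: B_def\<close>)
      ultimately show ?thesis by linarith
    qed
  qed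
  moreover have "2 * C * ((x + y) / 2 * (1 - (x + y) / 2))
      = B + C * d\<^sup>2 / 2 + C * (y * (1 - y))"
    by (simp add: B_def d_def power2_eq_square field_simps)
  ultimately show ?thesis using F1 by linarith
qed

section \<open>Slices along the last coordinate and \<open>hypercube_h\<close> on them\<close>

text \<open>Both slices live in the same smaller cube, so that they can be compared and the
  induction hypothesis applies to each.\<close>

definition slice :: "nat \<Rightarrow> (nat \<Rightarrow> nat) set \<Rightarrow> nat \<Rightarrow> (nat \<Rightarrow> nat) set" where
  "slice n A b = {x \<in> hypercube n. x(n := b) \<in> A}"

lemma slice_subset: "slice n A b \<subseteq> hypercube n"
  by (auto simp: slice_def)

lemma finite_slice: "finite (slice n A b)"
  using finite_subset[OF slice_subset finite_hypercube] .

lemma card_hypercube: "card (hypercube n) = 2 ^ n"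
  by (simp add: hypercube_def card_PiE numeral_2_eq_2)

lemma hypercube_Suc: "hypercube (Suc n) = (\<lambda>(b, x). x(n := b)) ` ({0, 1} \<times> hypercube n)"
  by (simp add: hypercube_def lessThan_Suc PiE_insert_eq)

lemma mem_hypercube_iff:
  "x \<in> hypercube n \<longleftrightarrow> (\<forall>i<n. x i = 0 \<or> x i = 1) \<and> (\<forall>i\<ge>n. x i = undefined)"
  by (auto simp: hypercube_def PiE_iff extensional_def not_less)

lemma flip_in_hypercube:
  "x \<in> hypercube n \<Longrightarrow> i < n \<Longrightarrow> x(i := 1 - x i) \<in> hypercube n"
  by (auto simp: mem_hypercube_iff)

lemma inj_on_extend: "inj_on (\<lambda>x. x(n := b)) (hypercube n)"
proof (rule inj_onI)
  fix x y :: "nat \<Rightarrow> nat"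
  assume "x \<in> hypercube n" "y \<in> hypercube n" and eq: "x(n := b) = y(n := b)"
  hence "x n = y n"
    by (simp add: mem_hypercube_iff)
  with eq show "x = y"
    by (metis fun_upd_triv fun_upd_upd)
qed

lemma sum_slices:
  fixes f :: "(nat \<Rightarrow> nat) \<Rightarrow> 'a::comm_monoid_add"
  assumes "A \<subseteq> hypercube (Suc n)"
  shows "sum f A = (\<Sum>x\<in>slice n A 0. f (x(n := 0))) + (\<Sum>x\<in>slice n A 1. f (x(n := 1)))"
proof -
  have A: "A = (\<lambda>x. x(n := 0)) ` slice n A 0 \<union> (\<lambda>x. x(n := 1)) ` slice n A 1"
  proof (intro equalityI subsetI)
    fix z assume z: "z \<in> A"
    hence "z \<in> (\<lambda>(b, x). x(n := b)) ` ({0, 1} \<times> hypercube n)"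
      using assms unfolding hypercube_Suc by blast
    then obtain b x where "b \<in> {0, 1}" "x \<in> hypercube n" "z = x(n := b)"
      by (elim imageE SigmaE) simp
    with z show "z \<in> (\<lambda>x. x(n := 0)) ` slice n A 0 \<union> (\<lambda>x. x(n := 1)) ` slice n A 1"
      by (auto simp: slice_def)
  qed (auto simp: slice_def)
  have disj: "(\<lambda>x. x(n := 0)) ` slice n A 0 \<inter> (\<lambda>x. x(n := 1)) ` slice n A 1 = {}"
    by (auto dest: fun_cong[of _ _ n])
  have inj: "inj_on (\<lambda>x. x(n := b)) (slice n A b)" for b
    using inj_on_subset[OF inj_on_extend slice_subset] .
  show ?thesis
    by (subst A, subst sum.union_disjoint)
       (auto simp: finite_slice disj sum.reindex[OF inj] simp del: One_nat_def)
qed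

text \<open>Neighbours correspond to flipped coordinates. Counting directions allows the last one to
  be split off, and shows that the value is a natural number.\<close>

lemma hypercube_h_eq_card_flips:
  assumes "A \<subseteq> hypercube n" "x \<in> A"
  shows "hypercube_h n A x = real (card {i. i < n \<and> x(i := 1 - x i) \<notin> A})"
proof -
  have x: "x \<in> hypercube n" using assms by blast
  hence x01: "x i = 0 \<or> x i = 1" if "i < n" for i
    using that by (simp add: mem_hypercube_iff)
  \<comment> \<open>Subtraction is truncated, yet \<open>1 - m\<close> differs from \<open>m\<close>
    for every natural \<open>m\<close>.\<close>
  have ne: "1 - x i \<noteq> x i" for i
    by arith
  have "bij_betw (\<lambda>i. x(i := 1 - x i)) {i. i < n \<and> x(i := 1 - x i) \<notin> A}
          {y \<in> hypercube n - A. hypercube_adj n x y}"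
    unfolding bij_betw_def
  proof (intro conjI set_eqI iffI)
    show "inj_on (\<lambda>i. x(i := 1 - x i)) {i. i < n \<and> x(i := 1 - x i) \<notin> A}"
    proof (rule inj_onI)
      fix i j assume "x(i := 1 - x i) = x(j := 1 - x j)"
      from fun_cong[OF this, of i] ne[of i] show "i = j"
        by (auto split: if_splits)
    qed
  next
    fix y assume "y \<in> (\<lambda>i. x(i := 1 - x i)) ` {i. i < n \<and> x(i := 1 - x i) \<notin> A}"
    then obtain i where i: "i < n" "y \<notin> A" "y = x(i := 1 - x i)" by auto
    have "{j. j < n \<and> x j \<noteq> y j} = {i}"
      using i ne[of i] by (auto split: if_splits)
    thus "y \<in> {y \<in> hypercube n - A. hypercube_adj n x y}"
      using i flip_in_hypercube x by (auto simp: hypercube_adj_def)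
  next
    fix y assume "y \<in> {y \<in> hypercube n - A. hypercube_adj n x y}"
    hence y: "y \<in> hypercube n" "y \<notin> A" and "card {i. i < n \<and> x i \<noteq> y i} = 1"
      by (auto simp: hypercube_adj_def)
    then obtain i where i: "{i. i < n \<and> x i \<noteq> y i} = {i}"
      by (auto simp: card_1_singleton_iff)
    hence "i < n" "x i \<noteq> y i" by auto
    have y01: "y i = 0 \<or> y i = 1"
      using y \<open>i < n\<close> by (simp add: mem_hypercube_iff)
    have "y j = (x(i := 1 - x i)) j" for j
    proof (cases "j < n")
      case True
      hence "x j \<noteq> y j \<longleftrightarrow> j = i"
        using i by blast
      moreover have "y i = 1 - x i"
        using x01[OF \<open>i < n\<close>] y01 \<open>x i \<noteq> y i\<close> by linarith
      ultimately show ?thesis by auto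
    next
      case False
      thus ?thesis
        using x y \<open>i < n\<close> by (auto simp: mem_hypercube_iff)
    qed
    hence "y = x(i := 1 - x i)" by blast
    thus "y \<in> (\<lambda>i. x(i := 1 - x i)) ` {i. i < n \<and> x(i := 1 - x i) \<notin> A}"
      using y \<open>i < n\<close> by auto
  qed
  from bij_betw_same_card[OF this] show ?thesis
    using assms by (simp add: hypercube_h_def)
qed

text \<open>Flips below \<open>n\<close> keep the last coordinate \<open>b\<close>; the flip at
  \<open>n\<close> leads to the other slice.\<close>

lemma hypercube_h_Suc:
  assumes A: "A \<subseteq> hypercube (Suc n)" and x: "x \<in> slice n A b" and b: "b \<le> 1"
  shows "hypercube_h (Suc n) A (x(n := b))
       = hypercube_h n (slice n A b) x + (if x \<in> slice n A (1 - b) then 0 else 1)"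
proof -
  let ?I = "{i. i < n \<and> x(i := 1 - x i) \<notin> slice n A b}"
  let ?J = "if x \<in> slice n A (1 - b) then {} else {n}"
  have xn: "x \<in> hypercube n" and xA: "x(n := b) \<in> A"
    using x by (auto simp: slice_def)
  have "{i. i < Suc n \<and> (x(n := b))(i := 1 - (x(n := b)) i) \<notin> A} = ?I \<union> ?J"
    using xn flip_in_hypercube[OF xn] by (auto simp: slice_def less_Suc_eq fun_upd_twist)
  moreover have "card (?I \<union> ?J) = card ?I + card ?J"
    by (rule card_Un_disjoint) auto
  ultimately show ?thesis
    using hypercube_h_eq_card_flips[OF A xA] hypercube_h_eq_card_flips[OF slice_subset x]
    by auto
qed

text \<open>At points missing from the other slice \<open>h\<close> grows by one and
  \<open>aq\<close> applies; at common points \<open>h\<close> is unchanged and the factor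
  \<open>1 - q \<le> 1\<close> only lowers the left side.\<close>

lemma sum_slice_ge:
  fixes a q \<beta> :: real
  assumes A: "A \<subseteq> hypercube (Suc n)" and b: "b \<le> 1" and q: "0 \<le> q"
    and aq: "\<And>h::nat. a + (1 - q) * h powr \<beta> \<le> (real h + 1) powr \<beta>"
  shows "(1 - q) * (\<Sum>x\<in>slice n A b. hypercube_h n (slice n A b) x powr \<beta>)
           + a * card (slice n A b - slice n A (1 - b))
       \<le> (\<Sum>x\<in>slice n A b. hypercube_h (Suc n) A (x(n := b)) powr \<beta>)"
proof -
  let ?S = "slice n A b" and ?T = "slice n A (1 - b)"
  let ?f = "\<lambda>x. hypercube_h n ?S x powr \<beta>"
  have "a * card (?S - ?T) = (\<Sum>x\<in>?S. if x \<in> ?T then 0 else a)"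
    by (simp add: sum.If_cases finite_slice Diff_eq mult.commute)
  hence "(1 - q) * sum ?f ?S + a * card (?S - ?T)
      = (\<Sum>x\<in>?S. (1 - q) * ?f x + (if x \<in> ?T then 0 else a))"
    by (simp add: sum.distrib sum_distrib_left)
  also have "\<dots> \<le> (\<Sum>x\<in>?S. hypercube_h (Suc n) A (x(n := b)) powr \<beta>)"
  proof (rule sum_mono)
    fix x assume x: "x \<in> ?S"
    obtain h :: nat where h: "hypercube_h n ?S x = h"
      using hypercube_h_eq_card_flips[OF slice_subset x] by blast
    have "(1 - q) * h powr \<beta> \<le> h powr \<beta>"
      using q mult_right_mono[of "1 - q" 1 "h powr \<beta>"] by simp
    thus "(1 - q) * ?f x + (if x \<in> ?T then 0 else a)
        \<le> hypercube_h (Suc n) A (x(n := b)) powr \<beta>"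
      unfolding hypercube_h_Suc[OF A x b] h using aq[of h] by (simp add: add_ac)
  qed
  finally show ?thesis .
qed

section \<open>Induction on the dimension, and passage to expectations\<close>

lemma sum_hypercube_h_ge:
  fixes \<beta> C :: real
  assumes \<beta>: "1 / 2 \<le> \<beta>" "2 powr \<beta> \<le> 3 / 2"
    and C: "C\<^sup>2 = 8 * (2 powr \<beta> - 1)" "0 < C"
    and A: "A \<subseteq> hypercube n"
  shows "C * (card A / 2 ^ n * (1 - card A / 2 ^ n))
       \<le> (\<Sum>x\<in>A. hypercube_h n A x powr \<beta>) / 2 ^ n"
  using A
proof (induction n arbitrary: A)
  case 0
  have "card A \<le> 1"
    using card_mono[OF finite_hypercube 0] by (simp add: card_hypercube)
  hence "card A = 0 \<or> card A = 1" by arith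
  thus ?case by (auto simp: sum_nonneg)
next
  case (Suc n)
  let ?S = "slice n A"
  let ?mu = "\<lambda>b. card (?S b) / 2 ^ n"
  let ?F = "\<lambda>b. (\<Sum>x\<in>?S b. hypercube_h n (?S b) x powr \<beta>) / 2 ^ n"
  let ?G = "\<lambda>b. (\<Sum>x\<in>?S b. hypercube_h (Suc n) A (x(n := b)) powr \<beta>) / 2 ^ n"
  have "card A = card (?S 0) + card (?S 1)"
    using sum_slices[OF Suc.prems, of "\<lambda>_. 1::nat"] by simp
  hence mu: "card A / 2 ^ Suc n = (?mu 0 + ?mu 1) / 2"
    by (simp add: field_simps)
  have sum: "(\<Sum>x\<in>A. hypercube_h (Suc n) A x powr \<beta>) / 2 ^ Suc n = (?G 0 + ?G 1) / 2"
    using sum_slices[OF Suc.prems, of "\<lambda>x. hypercube_h (Suc n) A x powr \<beta>"]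
    by (simp add: field_simps)
  have mu_le: "?mu b \<le> 1" for b
    using card_mono[OF finite_hypercube slice_subset, of n A b] by (simp add: card_hypercube)
  have G_ge: "(1 - q) * ?F b + a * (card (?S b - ?S (1 - b)) / 2 ^ n) \<le> ?G b"
    if "b \<le> 1" "0 \<le> q" "\<And>h::nat. a + (1 - q) * h powr \<beta> \<le> (real h + 1) powr \<beta>" for a q b
    using divide_right_mono[OF sum_slice_ge[OF Suc.prems that], of "2 ^ n"]
    by (simp add: add_divide_distrib)
  \<comment> \<open>Here \<open>b\<close> indexes the larger slice, which covers both orders of the
    two measures.\<close>
  have step: "2 * C * ((?mu b + ?mu (1 - b)) / 2 * (1 - (?mu b + ?mu (1 - b)) / 2))
      \<le> ?G b + ?G (1 - b)" if b: "b \<le> 1" and le: "?mu (1 - b) \<le> ?mu b" for b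
  proof -
    have "2 * C * ((?mu b + ?mu (1 - b)) / 2 * (1 - (?mu b + ?mu (1 - b)) / 2))
        \<le> ?G b + ?F (1 - b)"
    proof (rule two_point_step[OF \<beta> C _ le mu_le Suc.IH[OF slice_subset] Suc.IH[OF slice_subset]])
      have "real (card (?S b)) - card (?S (1 - b)) \<le> card (?S b - ?S (1 - b))"
        using diff_card_le_card_Diff[of "?S (1 - b)" "?S b"] finite_slice[of n A "1 - b"] by linarith
      from divide_right_mono[OF this, of "2 ^ n"]
      show "?mu b - ?mu (1 - b) \<le> card (?S b - ?S (1 - b)) / 2 ^ n"
        by (simp add: diff_divide_distrib)
    qed (use G_ge[OF b] in auto)
    \<comment> \<open>For the smaller slice monotonicity is enough:
      \<open>a = q = 0\<close>.\<close>
    moreover have "?F (1 - b) \<le> ?G (1 - b)"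
    proof -
      have "real h powr \<beta> \<le> (real h + 1) powr \<beta>" for h :: nat
        using \<beta> by (intro powr_mono2) auto
      thus ?thesis using G_ge[of "1 - b" 0 0] by (simp add: add.commute)
    qed
    ultimately show ?thesis by linarith
  qed
  have "2 * C * ((?mu 0 + ?mu 1) / 2 * (1 - (?mu 0 + ?mu 1) / 2)) \<le> ?G 0 + ?G 1"
  proof (cases "?mu 1 \<le> ?mu 0")
    case True
    thus ?thesis using step[of 0] by simp
  next
    case False
    thus ?thesis using step[of 1] by (simp add: add.commute)
  qed
  moreover have "C * u \<le> v / 2" if "2 * C * u \<le> v" for u v
    using that by simp
  ultimately show ?case
    unfolding mu sum by blast
qed

theorem theorem1p3:
  fixes \<beta> :: real and n :: nat and A :: "(nat \<Rightarrow> nat) set"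
  assumes "1 / 2 \<le> \<beta>" and "\<beta> \<le> log 2 (3 / 2)"
    and "n \<ge> 1"
    and "A \<subseteq> hypercube n"
  shows "measure_pmf.expectation (hypercube_unif n) (\<lambda>x. hypercube_h n A x powr \<beta>)
       \<ge> C_const \<beta> * measure_pmf.prob (hypercube_unif n) A
           * (1 - measure_pmf.prob (hypercube_unif n) A)"
proof -
  have \<beta>: "2 powr \<beta> \<le> 3 / 2"
    using assms(2) by (simp add: le_log_iff)
  have "2 powr \<beta> > 1"
    using assms(1) by simp
  hence C: "(C_const \<beta>)\<^sup>2 = 8 * (2 powr \<beta> - 1)" "0 < C_const \<beta>"
    by (auto simp: C_const_def power_mult_distrib powr_add)
  have prob: "measure_pmf.prob (hypercube_unif n) A = card A / 2 ^ n"
    using assms(4) unfolding hypercube_unif_def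
    by (simp add: measure_pmf_of_set hypercube_nonempty finite_hypercube card_hypercube Int_absorb1)
  \<comment> \<open>Off \<open>A\<close> the summand is \<open>0 powr \<beta> = 0\<close>.\<close>
  have "(\<Sum>x\<in>hypercube n. hypercube_h n A x powr \<beta>) = (\<Sum>x\<in>A. hypercube_h n A x powr \<beta>)"
    using assms(4) by (intro sum.mono_neutral_right) (auto simp: finite_hypercube hypercube_h_def)
  hence "measure_pmf.expectation (hypercube_unif n) (\<lambda>x. hypercube_h n A x powr \<beta>)
      = (\<Sum>x\<in>A. hypercube_h n A x powr \<beta>) / 2 ^ n"
    unfolding hypercube_unif_def
    by (simp add: integral_pmf_of_set hypercube_nonempty finite_hypercube card_hypercube)
  thus ?thesis
    using sum_hypercube_h_ge[OF assms(1) \<beta> C assms(4)] by (simp add: prob mult.assoc)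
qed

end
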